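(* Let $d\ge 2$, let $\Phi:\mathbb{S}^d\times\mathbb{S}^d\to\mathbb{R}$ be a positive definite zonal kernel with expansion coefficients $(c_\ell)_{\ell\ge 0}$, and let $\mathcal{L}=p(\Delta)$ with $p:\sigma(\Delta)\to\mathbb{R}$ such that $\lambda_\ell=p(\nu_\ell)$ grows at most algebraically in $\ell$ and $\sum_{\ell=0}^\infty c_\ell|\lambda_\ell|\ell^{d-1}<\infty$. Let $X\subset\mathbb{S}^d$ be a finite set of cardinality $N$, let $\mathbf{M}_X=\mathbf{K}_X\mathbf{\Phi}_X^{-1}$ be the global differentiation matrix of $\mathcal{L}$, and let $\mathbf{M}^\epsilon\in\mathbb{R}^{N\times N}$. Then for every eigenvalue $\lambda^\epsilon$ of $\mathbf{M}^\epsilon$ there is an eigenvalue $\lambda$ of $\mathbf{M}_X$ with $$|\lambda-\lambda^\epsilon|\le \mathrm{cond}(\mathbf{\Phi}_X^{1/2})\,\|\mathbf{M}_X-\mathbf{M}^\epsilon\|,$$ where $\mathrm{cond}(\mathbf{\Phi}_X^{1/2})=\|\mathbf{\Phi}_X^{1/2}\|\,\|\mathbf{\Phi}_X^{-1/2}\|$.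
   Context: $\mathbb{S}^d\subset\mathbb{R}^{d+1}$ is the unit sphere and $\Delta$ its Laplace-Beltrami operator, with eigenvalues $\nu_\ell=-\ell(\ell+d-1)$, $\ell=0,1,2,\dots$; $\{Y_\ell^\mu\}_{\mu=1}^{N_\ell}$ is an $L_2(\mathbb{S}^d)$-orthonormal basis of real spherical harmonics of degree $\ell$, so $\Delta Y_\ell^\mu=\nu_\ell Y_\ell^\mu$. The operator $\mathcal{L}=p(\Delta)$ acts by $\mathcal{L}Y_\ell^\mu=\lambda_\ell Y_\ell^\mu$ with $\lambda_\ell=p(\nu_\ell)$. A zonal kernel is one with an absolutely and uniformly convergent expansion $\Phi(x,y)=\sum_{\ell=0}^\infty\sum_{\mu\le N_\ell}c_\ell Y_\ell^\mu(x)Y_\ell^\mu(y)$. It is positive definite if for every finite set $X=\{x_1,\dots,x_N\}\subset\mathbb{S}^d$ of distinct points the collocation matrix $\mathbf{\Phi}_X=(\Phi(x_j,x_k))_{j,k}$ is strictly positive definite on $\mathbb{R}^N$. $\mathcal{L}$ is applied to the first argument of the kernel: $\mathcal{L}\Phi(x,y)=\sum_\ell\sum_\mu c_\ell\lambda_\ell Y_\ell^\mu(x)Y_\ell^\mu(y)$, and $\mathbf{K}_X=(\mathcal{L}\Phi(x_j,x_k))_{j,k}$. The global differentiation matrix $\mathbf{M}_X$ is the unique $N\times N$ matrix with $\mathbf{M}_X(u|_X)=(\mathcal{L}u)|_X$ for all $u\in\mathrm{span}\{\Phi(\cdot,x_j)\}_{j\le N}$; it equals $\mathbf{K}_X\mathbf{\Phi}_X^{-1}$.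 $\mathbf{\Phi}_X^{1/2}$ is the symmetric positive definite square root. $\|\cdot\|$ is the matrix norm induced by the Euclidean ($\ell_2$) vector norm. Eigenvalues of $\mathbf{M}^\epsilon$ may be complex. *)

theory Defs
  imports "HOL-Analysis.Analysis" "HOL-Library.Landau_Symbols"
begin

section \<open>Spherical harmonics and the Laplace-Beltrami operator\<close>

text \<open>
  Functions on the unit sphere are total functions on the ambient Euclidean space; only their
  values on \<open>sphere 0 1\<close> are ever constrained.
\<close>

definition laplacian :: "('a::euclidean_space \<Rightarrow> real) \<Rightarrow> 'a \<Rightarrow> real" where
  "laplacian f x = (\<Sum>b\<in>Basis. (deriv ^^ 2) (\<lambda>t. f (x + t *\<^sub>R b)) 0)"

text \<open>
  At a point of the unit sphere, the Laplace-Beltrami operator is the Euclidean Laplacian of the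
  extension that is constant along rays.
\<close>

definition laplace_beltrami :: "('a::euclidean_space \<Rightarrow> real) \<Rightarrow> 'a \<Rightarrow> real" where
  "laplace_beltrami f x = laplacian (\<lambda>y. f (y /\<^sub>R norm y)) x"

definition lb_eigenvalue :: "nat \<Rightarrow> nat \<Rightarrow> real" where
  "lb_eigenvalue d l = - (real l * (real l + real d - 1))"

definition harmonic_polynomial :: "nat \<Rightarrow> ('a::euclidean_space \<Rightarrow> real) \<Rightarrow> bool" where
  "harmonic_polynomial l P \<longleftrightarrow>
     real_polynomial_function P \<and>
     (\<forall>t x. P (t *\<^sub>R x) = t ^ l * P x) \<and>
     (\<forall>x. laplacian P x = 0)"

definition spherical_harmonic :: "nat \<Rightarrow> ('a::euclidean_space \<Rightarrow> real) \<Rightarrow> bool" where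
  "spherical_harmonic l f \<longleftrightarrow>
     (\<exists>P. harmonic_polynomial l P \<and> (\<forall>x\<in>sphere 0 1. f x = P x))"

text \<open>
  Surface measure: in polar coordinates the integral of \<open>f (x /\<^sub>R norm x)\<close> over the unit ball is
  \<open>1 / DIM('a)\<close> times the integral of \<open>f\<close> over the unit sphere.
\<close>

definition sphere_measure :: "'a::euclidean_space measure" where
  "sphere_measure =
     scale_measure (of_nat DIM('a))
       (distr (restrict_space lborel (ball 0 1 - {0})) (restrict_space borel (sphere 0 1))
          (\<lambda>x. x /\<^sub>R norm x))"

definition spherical_harmonic_basis ::
  "(nat \<Rightarrow> nat) \<Rightarrow> (nat \<Rightarrow> nat \<Rightarrow> 'a::euclidean_space \<Rightarrow> real) \<Rightarrow> bool" where
  "spherical_harmonic_basis n Y \<longleftrightarrow>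
     (\<forall>l. (\<forall>m\<in>{1..n l}. spherical_harmonic l (Y l m)) \<and>
          (\<forall>m\<in>{1..n l}. \<forall>m'\<in>{1..n l}.
             (LINT x|sphere_measure. Y l m x * Y l m' x) = (if m = m' then 1 else 0)) \<and>
          (\<forall>f. spherical_harmonic l f \<longrightarrow>
             (\<exists>a. \<forall>x\<in>sphere 0 1. f x = (\<Sum>m=1..n l. a m * Y l m x))))"

lemma euler_homogeneous:
  fixes P :: "'a::euclidean_space \<Rightarrow> real"
  assumes "real_polynomial_function P" and hom: "\<And>t x. P (t *\<^sub>R x) = t ^ l * P x"
  shows "(\<Sum>b\<in>Basis. (x \<bullet> b) * deriv (\<lambda>t. P (x + t *\<^sub>R b)) 0) = real l * P x"
proof -
  obtain P' where P': "(P has_derivative P') (at x)"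
    using differentiable_at_real_polynomial_function[OF assms(1)] unfolding differentiable_def by blast
  interpret P': bounded_linear P' using P' by (rule has_derivative_bounded_linear)
  have D: "((\<lambda>t. P (c *\<^sub>R x + t *\<^sub>R v)) has_real_derivative P' v) (at s)"
    if "c *\<^sub>R x + s *\<^sub>R v = x" for v s c
  proof -
    have "((\<lambda>t. c *\<^sub>R x + t *\<^sub>R v) has_derivative (\<lambda>h. h *\<^sub>R v)) (at s)"
      by (auto intro!: derivative_eq_intros)
    with P' have "((\<lambda>t. P (c *\<^sub>R x + t *\<^sub>R v)) has_derivative (\<lambda>h. P' (h *\<^sub>R v))) (at s)"
      using has_derivative_compose[of "\<lambda>t. c *\<^sub>R x + t *\<^sub>R v" "\<lambda>h. h *\<^sub>R v" s UNIV P P'] that by simp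
    then show ?thesis
      by (simp add: has_field_derivative_def P'.scaleR mult.commute[of _ "P' v"])
  qed
  have "deriv (\<lambda>t. P (x + t *\<^sub>R b)) 0 = P' b" for b
    using D[of 1 0 b] by (simp add: DERIV_imp_deriv)
  then have "(\<Sum>b\<in>Basis. (x \<bullet> b) * deriv (\<lambda>t. P (x + t *\<^sub>R b)) 0) = P' (\<Sum>b\<in>Basis. (x \<bullet> b) *\<^sub>R b)"
    by (simp add: P'.sum P'.scaleR)
  also have "\<dots> = P' x" by (simp add: euclidean_representation)
  finally have *: "(\<Sum>b\<in>Basis. (x \<bullet> b) * deriv (\<lambda>t. P (x + t *\<^sub>R b)) 0) = P' x" .
  have "((\<lambda>t. P (t *\<^sub>R x)) has_real_derivative P' x) (at 1)"
    using D[of 0 1 x] by simp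
  then have "((\<lambda>t. t ^ l * P x) has_real_derivative P' x) (at 1)"
    by (simp add: hom)
  moreover have "((\<lambda>t. t ^ l * P x) has_real_derivative real l * P x) (at 1)"
    by (auto intro!: derivative_eq_intros)
  ultimately have "P' x = real l * P x" by (rule DERIV_unique)
  with * show ?thesis by simp
qed

text \<open>Spherical harmonics of degree \<open>l\<close> are eigenfunctions for the eigenvalue \<open>lb_eigenvalue d l\<close>.\<close>

lemma laplace_beltrami_spherical_harmonic:
  fixes f :: "'a::euclidean_space \<Rightarrow> real"
  assumes "spherical_harmonic l f" and "DIM('a) = d + 1" and x: "x \<in> sphere 0 1"
  shows "laplace_beltrami f x = lb_eigenvalue d l * f x"
proof -
  obtain P where P: "real_polynomial_function P" and hom: "\<And>t x. P (t *\<^sub>R x) = t ^ l * P x"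
    and lap: "laplacian P x = 0" and f: "\<And>y. y \<in> sphere 0 1 \<Longrightarrow> f y = P y"
    using assms(1) unfolding spherical_harmonic_def harmonic_polynomial_def by blast
  have [simp]: "norm x = 1" "x \<bullet> x = 1" using x by (auto simp: dot_square_norm)
  define a where "a = - real l / 2"
  have main: "(deriv ^^ 2) (\<lambda>t. f ((x + t *\<^sub>R b) /\<^sub>R norm (x + t *\<^sub>R b))) 0
       = (real l * (real l + 2) * (x \<bullet> b)\<^sup>2 - real l) * P x
         - 2 * real l * ((x \<bullet> b) * deriv (\<lambda>t. P (x + t *\<^sub>R b)) 0)
         + (deriv ^^ 2) (\<lambda>t. P (x + t *\<^sub>R b)) 0" if b: "b \<in> Basis" for b
  proof -
    define g where "g = (\<lambda>t. P (x + t *\<^sub>R b))"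
    have "polynomial_function (\<lambda>t::real. x + t *\<^sub>R b)"
      by (intro polynomial_function_add polynomial_function_const
          polynomial_function_bounded_linear bounded_linear_scaleR_left)
    from real_polynomial_function_compose[OF this P] have g: "real_polynomial_function g"
      by (simp add: g_def o_def)
    obtain g1 where g1: "real_polynomial_function g1" "\<And>t. (g has_real_derivative g1 t) (at t)"
      using has_real_derivative_polynomial_function[OF g] by blast
    obtain g2 where g2: "\<And>t. (g1 has_real_derivative g2 t) (at t)"
      using has_real_derivative_polynomial_function[OF g1(1)] by blast
    have dg: "deriv g = g1" "deriv g1 = g2"
      using g1 g2 by (auto simp: DERIV_imp_deriv)
    define q where "q = (\<lambda>t. 1 + 2 * t * (x \<bullet> b) + t\<^sup>2)"
    have q: "(norm (x + t *\<^sub>R b))\<^sup>2 = q t" for t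
      using b unfolding power2_norm_eq_inner
      by (simp add: q_def inner_add_left inner_add_right inner_commute power2_eq_square)
    define S where "S = {t. 0 < q t}"
    have S: "open S" "0 \<in> S"
      by (auto simp: S_def q_def intro!: open_Collect_less continuous_intros)
    have eq: "f ((x + t *\<^sub>R b) /\<^sub>R norm (x + t *\<^sub>R b)) = q t powr a * g t" if "t \<in> S" for t
    proof -
      let ?n = "norm (x + t *\<^sub>R b)"
      have n: "?n > 0" using that q[of t] by (auto simp: S_def simp del: norm_eq_zero)
      have "f ((x + t *\<^sub>R b) /\<^sub>R ?n) = inverse ?n ^ l * g t"
        using n by (subst f) (auto simp: hom g_def)
      also have "inverse ?n ^ l = ?n powr (2 * a)"
        using n by (simp add: a_def powr_minus powr_realpow power_inverse)
      also have "\<dots> = q t powr a"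
        using n by (simp add: powr_powr[symmetric] flip: q)
      finally show ?thesis .
    qed
    define h where "h = (\<lambda>t. f ((x + t *\<^sub>R b) /\<^sub>R norm (x + t *\<^sub>R b)))"
    define q' where "q' = (\<lambda>t. 2 * (x \<bullet> b) + 2 * t)"
    define h1 where "h1 = (\<lambda>t. a * q t powr (a - 1) * q' t * g t + q t powr a * g1 t)"
    have dq: "(q has_real_derivative q' t) (at t)" for t
      unfolding q_def q'_def by (auto intro!: derivative_eq_intros)
    have dq': "(q' has_real_derivative 2) (at t)" for t
      unfolding q'_def by (auto intro!: derivative_eq_intros)
    have dp: "((\<lambda>t. q t powr r) has_real_derivative r * q t powr (r - 1) * q' t) (at t)"
      if "t \<in> S" for t r
      using DERIV_fun_powr[OF dq, of t r] that by (simp add: S_def mult_ac)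
    have "((\<lambda>t. q t powr a * g t) has_real_derivative h1 t) (at t)" if "t \<in> S" for t
      using DERIV_mult[OF dp[OF that, of a] g1(2)] by (simp add: h1_def algebra_simps)
    then have "(h has_real_derivative h1 t) (at t)" if "t \<in> S" for t
      using has_field_derivative_transform_within_open[OF _ S(1) that, of "\<lambda>t. q t powr a * g t" "h1 t" h]
        eq that by (simp add: h_def)
    then have h1: "deriv h t = h1 t" if "t \<in> S" for t
      using that by (simp add: DERIV_imp_deriv)
    define A where "A = a * (a - 1) * (q' 0)\<^sup>2 * g 0 + a * 2 * g 0 + 2 * a * q' 0 * g1 0 + g2 0"
    have "(h1 has_real_derivative A) (at 0)"
    proof -
      have [simp]: "q 0 = 1" by (simp add: q_def)
      show ?thesis unfolding h1_def A_def
        by (rule derivative_eq_intros dp dq' g1 g2 S refl)+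
          (simp add: algebra_simps power2_eq_square)
    qed
    then have "(deriv h has_real_derivative A) (at 0)"
      using has_field_derivative_transform_within_open[OF _ S, of h1 A "deriv h"] h1 by simp
    then have "(deriv ^^ 2) h 0 = A" by (simp add: numeral_2_eq_2 DERIV_imp_deriv)
    moreover have "A = (real l * (real l + 2) * (x \<bullet> b)\<^sup>2 - real l) * g 0
         - 2 * real l * ((x \<bullet> b) * g1 0) + g2 0"
      by (simp add: A_def a_def q'_def field_simps power2_eq_square)
    moreover have "(deriv ^^ 2) g 0 = g2 0" by (simp add: numeral_2_eq_2 dg)
    moreover have "g 0 = P x" by (simp add: g_def)
    ultimately show ?thesis using dg(1) by (simp add: h_def g_def)
  qed
  have sq: "(\<Sum>b\<in>Basis. (x \<bullet> b)\<^sup>2) = 1"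
    using euclidean_inner[of x x] by (simp add: power2_eq_square)
  have "laplace_beltrami f x
      = (\<Sum>b\<in>Basis. (real l * (real l + 2) * (x \<bullet> b)\<^sup>2 - real l) * P x)
        - 2 * real l * (\<Sum>b\<in>Basis. (x \<bullet> b) * deriv (\<lambda>t. P (x + t *\<^sub>R b)) 0) + laplacian P x"
    unfolding laplace_beltrami_def laplacian_def
    by (simp add: main sum.distrib sum_subtractf sum_distrib_left)
  also have "(\<Sum>b\<in>Basis. (real l * (real l + 2) * (x \<bullet> b)\<^sup>2 - real l) * P x)
      = (real l * (real l + 2) - real l * (real d + 1)) * P x"
    using assms(2) sq
    by (simp add: sum_distrib_right[symmetric] sum_subtractf sum_distrib_left[symmetric])
  also have "\<dots> - 2 * real l * (\<Sum>b\<in>Basis. (x \<bullet> b) * deriv (\<lambda>t. P (x + t *\<^sub>R b)) 0) + laplacian P x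
      = lb_eigenvalue d l * P x"
    unfolding euler_homogeneous[OF P hom] lap by (simp add: lb_eigenvalue_def algebra_simps)
  finally show ?thesis using f[OF x] by simp
qed


section \<open>Kernels\<close>

definition zonal_series ::
  "(nat \<Rightarrow> nat) \<Rightarrow> (nat \<Rightarrow> nat \<Rightarrow> 'a \<Rightarrow> real) \<Rightarrow> (nat \<Rightarrow> real) \<Rightarrow> 'a \<Rightarrow> 'a \<Rightarrow> real" where
  "zonal_series n Y c x y = (\<Sum>l. \<Sum>m=1..n l. c l * Y l m x * Y l m y)"

definition zonal_kernel ::
  "(nat \<Rightarrow> nat) \<Rightarrow> (nat \<Rightarrow> nat \<Rightarrow> 'a::euclidean_space \<Rightarrow> real) \<Rightarrow> (nat \<Rightarrow> real)
    \<Rightarrow> ('a \<Rightarrow> 'a \<Rightarrow> real) \<Rightarrow> bool" where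
  "zonal_kernel n Y c \<Phi> \<longleftrightarrow>
     (\<forall>x\<in>sphere 0 1. \<forall>y\<in>sphere 0 1. summable (\<lambda>l. \<Sum>m=1..n l. \<bar>c l * Y l m x * Y l m y\<bar>)) \<and>
     uniform_limit (sphere 0 1 \<times> sphere 0 1)
       (\<lambda>k (x, y). \<Sum>l<k. \<Sum>m=1..n l. c l * Y l m x * Y l m y) (\<lambda>(x, y). \<Phi> x y) sequentially"

definition positive_definite_kernel :: "('a::euclidean_space \<Rightarrow> 'a \<Rightarrow> real) \<Rightarrow> bool" where
  "positive_definite_kernel \<Phi> \<longleftrightarrow>
     (\<forall>X v. finite X \<longrightarrow> X \<subseteq> sphere 0 1 \<longrightarrow> (\<exists>x\<in>X. v x \<noteq> 0) \<longrightarrow>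
        0 < (\<Sum>x\<in>X. \<Sum>y\<in>X. v x * \<Phi> x y * v y))"

text \<open>
  Let \<open>L = p(\<Delta>)\<close>, so that \<open>L (Y l m) = p (lb_eigenvalue d l) * Y l m\<close>. This is the kernel obtained by
  applying \<open>L\<close> termwise to the first argument of the zonal kernel with coefficients \<open>c\<close>. Only the
  values of \<open>p\<close> on the spectrum of \<open>\<Delta>\<close>, the numbers \<open>lb_eigenvalue d l\<close>, are used.
\<close>

definition operator_kernel ::
  "nat \<Rightarrow> (real \<Rightarrow> real) \<Rightarrow> (nat \<Rightarrow> nat) \<Rightarrow> (nat \<Rightarrow> nat \<Rightarrow> 'a \<Rightarrow> real) \<Rightarrow> (nat \<Rightarrow> real)
    \<Rightarrow> 'a \<Rightarrow> 'a \<Rightarrow> real" where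
  "operator_kernel d p n Y c = zonal_series n Y (\<lambda>l. c l * p (lb_eigenvalue d l))"


section \<open>Matrices\<close>

text \<open>The points are enumerated by a finite type \<open>'m\<close>, so that \<open>N = CARD('m)\<close>.\<close>

definition kernel_matrix :: "('a \<Rightarrow> 'a \<Rightarrow> real) \<Rightarrow> ('m \<Rightarrow> 'a) \<Rightarrow> real ^ 'm ^ 'm" where
  "kernel_matrix \<Phi> x = (\<chi> j k. \<Phi> (x j) (x k))"

definition differentiation_matrix ::
  "('a \<Rightarrow> 'a \<Rightarrow> real) \<Rightarrow> ('a \<Rightarrow> 'a \<Rightarrow> real) \<Rightarrow> ('m \<Rightarrow> 'a) \<Rightarrow> real ^ 'm ^ 'm::finite" where
  "differentiation_matrix L\<Phi> \<Phi> x = kernel_matrix L\<Phi> x ** matrix_inv (kernel_matrix \<Phi> x)"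

text \<open>
  The differentiation matrix maps \<open>u|\<^sub>X\<close> to \<open>(L u)|\<^sub>X\<close> for every \<open>u = (\<Sum>k. a k * \<Phi>(\<cdot>, x k))\<close> in
  the trial space, and is the only matrix that does.
\<close>

lemma differentiation_matrix_unique:
  fixes x :: "'m::finite \<Rightarrow> 'a"
  assumes inv: "invertible (kernel_matrix \<Phi> x)"
  shows "(\<forall>a. M *v (\<chi> j. \<Sum>k\<in>UNIV. a k * \<Phi> (x j) (x k)) = (\<chi> j. \<Sum>k\<in>UNIV. a k * L\<Phi> (x j) (x k)))
           \<longleftrightarrow> M = differentiation_matrix L\<Phi> \<Phi> x"
proof -
  let ?F = "kernel_matrix \<Phi> x" and ?K = "kernel_matrix L\<Phi> x"
  have vec: "(\<chi> j. \<Sum>k\<in>UNIV. a k * \<Psi> (x j) (x k)) = kernel_matrix \<Psi> x *v (\<chi> k. a k)"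
    for a and \<Psi> :: "'a \<Rightarrow> 'a \<Rightarrow> real"
    by (simp add: kernel_matrix_def matrix_vector_mult_def mult.commute)
  have "(\<forall>a. M *v (?F *v (\<chi> k. a k)) = ?K *v (\<chi> k. a k)) \<longleftrightarrow> (\<forall>v. (M ** ?F) *v v = ?K *v v)"
    unfolding matrix_vector_mul_assoc by (metis vec_lambda_eta)
  also have "\<dots> \<longleftrightarrow> M ** ?F = ?K"
    by (metis matrix_eq)
  also have "\<dots> \<longleftrightarrow> M = ?K ** matrix_inv ?F"
    using someI_ex[OF inv[unfolded invertible_def], folded matrix_inv_def]
    by (metis matrix_mul_assoc matrix_mul_rid)
  finally show ?thesis unfolding vec differentiation_matrix_def .
qed

definition spd_matrix :: "real ^ 'm ^ 'm::finite \<Rightarrow> bool" where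
  "spd_matrix A \<longleftrightarrow> transpose A = A \<and> (\<forall>v. v \<noteq> 0 \<longrightarrow> 0 < v \<bullet> (A *v v))"

definition matrix_sqrt :: "real ^ 'm ^ 'm::finite \<Rightarrow> real ^ 'm ^ 'm" where
  "matrix_sqrt A = (THE B. spd_matrix B \<and> B ** B = A)"

definition matrix_norm :: "real ^ 'm ^ 'm::finite \<Rightarrow> real" where
  "matrix_norm A = onorm ((*v) A)"

definition condition_number :: "real ^ 'm ^ 'm::finite \<Rightarrow> real" where
  "condition_number A = matrix_norm A * matrix_norm (matrix_inv A)"

definition complex_eigenvalue :: "real ^ 'm ^ 'm::finite \<Rightarrow> complex \<Rightarrow> bool" where
  "complex_eigenvalue A z \<longleftrightarrow> (\<exists>v. v \<noteq> 0 \<and> map_matrix complex_of_real A *v v = z *s v)"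

end

theory Submission
  imports Defs
begin

text \<open>
  With \<open>B\<close> the square root of the collocation matrix, the differentiation matrix is similar to the
  symmetric matrix \<open>B\<^sup>-\<^sup>1 K B\<^sup>-\<^sup>1\<close> via \<open>B\<close>. A real symmetric matrix has an orthonormal eigenbasis, so
  expanding the residual of a perturbed eigenvector in that basis gives the Bauer-Fike bound, in which
  the similarity transformation enters through its condition number.
\<close>

section \<open>The spectral theorem for symmetric operators\<close>

text \<open>The quadratic form \<open>y \<bullet> f y\<close> attains its maximum on the compact
  unit sphere of \<open>V\<close>. Its first variation vanishes at a maximiser \<open>v\<close>, and
  testing it in the direction of \<open>f v - \<nu> *\<^sub>R v\<close>, which invariance keeps
  inside \<open>V\<close>, forces this residual to be zero.\<close>

lemma symmetric_eigenvector_exists: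
  fixes f :: "'a::euclidean_space \<Rightarrow> 'a"
  assumes f: "linear f" and sym: "\<And>x y. x \<bullet> f y = f x \<bullet> y"
    and V: "subspace V" "f ` V \<subseteq> V" "V \<noteq> {0}"
  obtains v \<nu> where "v \<in> V" "norm v = 1" "f v = \<nu> *\<^sub>R v"
proof -
  interpret linear f by (rule f)
  have cl: "closed V" using V(1) by (rule closed_subspace)
  have cont: "continuous_on S f" for S
    using f by (simp add: linear_continuous_on linear_conv_bounded_linear)
  obtain w where w: "w \<in> V" "w \<noteq> 0" using V(1,3) subspace_0 by blast
  have "w /\<^sub>R norm w \<in> V \<inter> sphere 0 1" using w V(1) by (simp add: subspace_scale)
  then have "\<exists>v\<in>V \<inter> sphere 0 1. \<forall>y\<in>V \<inter> sphere 0 1. y \<bullet> f y \<le> v \<bullet> f v"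
    using cl by (intro continuous_attains_sup closed_Int_compact continuous_intros cont) auto
  then obtain v where v: "v \<in> V" "norm v = 1"
    and max: "\<And>y. y \<in> V \<Longrightarrow> norm y = 1 \<Longrightarrow> y \<bullet> f y \<le> v \<bullet> f v" by auto
  define \<nu> where "\<nu> = v \<bullet> f v"
  have bound: "y \<bullet> f y \<le> \<nu> * (y \<bullet> y)" if "y \<in> V" for y
  proof (cases "y = 0")
    case True
    then show ?thesis by (simp add: zero)
  next
    case False
    have "(y /\<^sub>R norm y) \<bullet> f (y /\<^sub>R norm y) \<le> \<nu>"
      unfolding \<nu>_def using False that V(1) by (intro max) (auto simp: subspace_scale)
    then have "(y \<bullet> f y) / (norm y)\<^sup>2 \<le> \<nu>"
      by (simp add: scale power2_eq_square field_simps)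
    then show ?thesis using False by (simp add: divide_le_eq dot_square_norm)
  qed
  define r where "r = f v - \<nu> *\<^sub>R v"
  have r: "r \<in> V" unfolding r_def using v V by (auto intro!: subspace_diff subspace_scale)
  have vv: "v \<bullet> v = 1" using v by (simp add: dot_square_norm)
  \<comment> \<open>This is \<open>bound\<close> at \<open>v + t *\<^sub>R r\<close>: the constant
    terms cancel, and the linear terms combine to 2 t |r|^2 because r is the residual
    itself.\<close>
  have first_order: "2 * t * (r \<bullet> r) \<le> t\<^sup>2 * (\<nu> * (r \<bullet> r) - r \<bullet> f r)" for t
  proof -
    have "v + t *\<^sub>R r \<in> V" using v r V(1) by (simp add: subspace_add subspace_scale)
    from bound[OF this]
    have "\<nu> + 2 * t * (r \<bullet> f v) + t\<^sup>2 * (r \<bullet> f r) \<le> \<nu> * (1 + 2 * t * (r \<bullet> v) + t\<^sup>2 * (r \<bullet> r))"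
      using sym[of v r]
      by (simp add: add scale inner_add_left inner_add_right \<nu>_def[symmetric] vv inner_commute
          power2_eq_square algebra_simps)
    moreover have "r \<bullet> f v = r \<bullet> r + \<nu> * (r \<bullet> v)"
      by (simp add: r_def algebra_simps inner_commute)
    ultimately show ?thesis by (simp add: algebra_simps)
  qed
  have "r \<bullet> r = 0"
  proof (rule ccontr)
    assume "r \<bullet> r \<noteq> 0"
    then have pos: "r \<bullet> r > 0" by simp
    \<comment> \<open>\<open>C\<close> dominates the quadratic coefficient, and the added 1 keeps it
      positive. The chosen \<open>t\<close> makes the quadratic side at most t |r|^2, half of the
      linear side.\<close>
    define C where "C = \<bar>\<nu> * (r \<bullet> r) - r \<bullet> f r\<bar> + 1"
    define t where "t = (r \<bullet> r) / C"
    have C: "C > 0" by (simp add: C_def)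
    have t: "t > 0" using pos C by (simp add: t_def)
    have "2 * t * (r \<bullet> r) \<le> t\<^sup>2 * (\<nu> * (r \<bullet> r) - r \<bullet> f r)" by (rule first_order)
    also have "\<dots> \<le> t\<^sup>2 * C" by (intro mult_left_mono) (auto simp: C_def)
    also have "\<dots> = t * (r \<bullet> r)" using C by (simp add: t_def power2_eq_square)
    finally show False using t pos by simp
  qed
  then have "f v = \<nu> *\<^sub>R v" by (simp add: r_def)
  with v show ?thesis by (rule that)
qed

text \<open>Induction on the dimension: split off a unit eigenvector and continue in its orthogonal
  complement within \<open>V\<close>. Invariant subspaces appear in the statement so that the
  induction hypothesis applies to this complement.\<close>

lemma symmetric_orthonormal_eigenbasis:
  fixes f :: "'a::euclidean_space \<Rightarrow> 'a"
  assumes f: "linear f" and sym: "\<And>x y. x \<bullet> f y = f x \<bullet> y"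
    and "subspace V" "f ` V \<subseteq> V"
  shows "\<exists>B \<nu>. finite B \<and> B \<subseteq> V \<and> (\<forall>e\<in>B. f e = \<nu> e *\<^sub>R e) \<and>
           (\<forall>e\<in>B. \<forall>e'\<in>B. e \<bullet> e' = (if e = e' then 1 else 0)) \<and>
           (\<forall>v\<in>V. v = (\<Sum>e\<in>B. (e \<bullet> v) *\<^sub>R e))"
  using assms(3,4)
proof (induction "dim V" arbitrary: V rule: less_induct)
  case less
  interpret linear f by (rule f)
  show ?case
  proof (cases "V = {0}")
    case True
    then show ?thesis by (intro exI[of _ "{}"]) auto
  next
    case False
    obtain v \<mu> where v: "v \<in> V" "norm v = 1" "f v = \<mu> *\<^sub>R v"
      using symmetric_eigenvector_exists[OF f sym less.prems False] by blast
    have vv: "v \<bullet> v = 1" using v by (simp add: dot_square_norm)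
    define W where "W = {y \<in> V. v \<bullet> y = 0}"
    have W: "subspace W"
      using less.prems(1) by (auto simp: W_def subspace_def inner_add_right)
    \<comment> \<open>Symmetry moves f onto the eigenvector: v . f y = f v . y = \<mu> (v . y) =
      0.\<close>
    have "f y \<in> W" if "y \<in> W" for y
      using that less.prems(2) sym[of v y] v(3) by (auto simp: W_def)
    then have fW: "f ` W \<subseteq> W" by blast
    have "W \<subseteq> V" "v \<notin> W" by (auto simp: W_def vv)
    then have "W \<subset> V" using v(1) by blast
    then have "dim W < dim V"
      using W less.prems(1) by (intro dim_psubset) (simp add: span_eq_iff[THEN iffD2])
    from less.hyps[OF this W fW] obtain B \<nu> where "finite B" "B \<subseteq> W"
      "\<forall>e\<in>B. f e = \<nu> e *\<^sub>R e"
      "\<forall>e\<in>B. \<forall>e'\<in>B. e \<bullet> e' = (if e = e' then 1 else 0)"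
      "\<forall>v\<in>W. v = (\<Sum>e\<in>B. (e \<bullet> v) *\<^sub>R e)" by (elim exE conjE)
    note B = this(1,2) bspec[OF this(3)] bspec[OF bspec[OF this(4)]] bspec[OF this(5)]
    have vB: "v \<notin> B" using B(2) \<open>v \<notin> W\<close> by blast
    have orth: "v \<bullet> e = 0" "e \<bullet> v = 0" if "e \<in> B" for e
      using that B(2) by (auto simp: W_def inner_commute)
    have expand: "y = (\<Sum>e\<in>insert v B. (e \<bullet> y) *\<^sub>R e)" if y: "y \<in> V" for y
    proof -
      \<comment> \<open>Removing the v-component leaves the coefficients along \<open>B\<close>
        unchanged, since \<open>B\<close> is orthogonal to v.\<close>
      have "y - (v \<bullet> y) *\<^sub>R v \<in> W"
        using y v less.prems(1) vv
        by (auto simp: W_def inner_diff_right intro!: subspace_diff subspace_scale)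
      from B(5)[OF this] have "y - (v \<bullet> y) *\<^sub>R v = (\<Sum>e\<in>B. (e \<bullet> y) *\<^sub>R e)"
        by (simp add: inner_diff_right orth)
      then show ?thesis using B(1) vB by (simp add: algebra_simps)
    qed
    show ?thesis
    proof (intro exI[of _ "insert v B"] exI[of _ "\<nu>(v := \<mu>)"] conjI ballI)
      show "finite (insert v B)" using B(1) by simp
      show "insert v B \<subseteq> V" using B(2) v(1) by (auto simp: W_def)
      show "f e = (\<nu>(v := \<mu>)) e *\<^sub>R e" if "e \<in> insert v B" for e
        using that v(3) B(3) by auto
      show "e \<bullet> e' = (if e = e' then 1 else 0)" if "e \<in> insert v B" "e' \<in> insert v B" for e e'
        using that vv orth B(4) vB by auto
    qed (rule expand)
  qed
qed

section \<open>The spectral theorem in matrix form\<close>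

lemma symmetric_matrix_inner:
  fixes A :: "real ^ 'm ^ 'm::finite"
  assumes "transpose A = A"
  shows "x \<bullet> (A *v y) = (A *v x) \<bullet> y"
  by (metis assms dot_lmul_matrix transpose_matrix_vector)

lemma symmetric_matrixI:
  fixes A :: "real ^ 'm ^ 'm::finite"
  assumes "\<And>x y. x \<bullet> (A *v y) = (A *v x) \<bullet> y"
  shows "transpose A = A"
proof -
  have "transpose A *v x = A *v x" for x
  proof -
    have "(transpose A *v x) \<bullet> y = (A *v x) \<bullet> y" for y
      using assms[of x y] by (simp add: dot_lmul_matrix)
    then show ?thesis by (metis vector_eq_rdot)
  qed
  then show ?thesis by (simp add: matrix_eq del: transpose_matrix_vector)
qed

definition orthonormal_eigenbasis ::
  "real ^ 'm ^ 'm::finite \<Rightarrow> (real ^ 'm) set \<Rightarrow> (real ^ 'm \<Rightarrow> real) \<Rightarrow> bool" where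
  "orthonormal_eigenbasis A B \<nu> \<longleftrightarrow> finite B \<and> (\<forall>e\<in>B. A *v e = \<nu> e *\<^sub>R e) \<and>
     (\<forall>e\<in>B. \<forall>e'\<in>B. e \<bullet> e' = (if e = e' then 1 else 0)) \<and>
     (\<forall>v. v = (\<Sum>e\<in>B. (e \<bullet> v) *\<^sub>R e))"

lemma orthonormal_eigenbasisD:
  assumes "orthonormal_eigenbasis A B \<nu>"
  shows "finite B" and "\<And>e. e \<in> B \<Longrightarrow> A *v e = \<nu> e *\<^sub>R e"
    and "\<And>e e'. e \<in> B \<Longrightarrow> e' \<in> B \<Longrightarrow> e \<bullet> e' = (if e = e' then 1 else 0)"
    and "\<And>v. v = (\<Sum>e\<in>B. (e \<bullet> v) *\<^sub>R e)"
  using assms unfolding orthonormal_eigenbasis_def by (elim conjE; metis)+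

lemma symmetric_matrix_orthonormal_eigenbasis:
  fixes A :: "real ^ 'm ^ 'm::finite"
  assumes "transpose A = A"
  obtains B \<nu> where "orthonormal_eigenbasis A B \<nu>"
proof -
  have "linear ((*v) A)" by simp
  from symmetric_orthonormal_eigenbasis[OF this symmetric_matrix_inner[OF assms] subspace_UNIV
      subset_UNIV]
  obtain B \<nu> where "finite B" "\<forall>e\<in>B. A *v e = \<nu> e *\<^sub>R e"
    "\<forall>e\<in>B. \<forall>e'\<in>B. e \<bullet> e' = (if e = e' then 1 else 0)"
    "\<forall>v\<in>UNIV. v = (\<Sum>e\<in>B. (e \<bullet> v) *\<^sub>R e)" by (elim exE conjE)
  then have "orthonormal_eigenbasis A B \<nu>"
    unfolding orthonormal_eigenbasis_def ball_UNIV by (intro conjI)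
  then show ?thesis by (rule that)
qed

lemma parseval:
  assumes "v = (\<Sum>e\<in>B. (e \<bullet> v) *\<^sub>R e)"
  shows "(norm v)\<^sup>2 = (\<Sum>e\<in>B. (e \<bullet> v)\<^sup>2)"
proof -
  have "v \<bullet> v = v \<bullet> (\<Sum>e\<in>B. (e \<bullet> v) *\<^sub>R e)" using assms by simp
  also have "\<dots> = (\<Sum>e\<in>B. (e \<bullet> v)\<^sup>2)"
    by (simp add: inner_sum_right power2_eq_square inner_commute)
  finally show ?thesis by (simp add: dot_square_norm)
qed

section \<open>Square roots of positive definite matrices\<close>

lemma spd_matrix_invertible:
  assumes "spd_matrix A"
  shows "invertible A"
proof -
  have "x = 0" if "A *v x = 0" for x
    using assms that unfolding spd_matrix_def by (metis inner_zero_right less_irrefl)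
  then show ?thesis unfolding invertible_left_inverse matrix_left_invertible_ker by blast
qed

text \<open>Keep an orthonormal eigenbasis of \<open>A\<close> and replace each eigenvalue by its
  square root; definiteness tested on the eigenvectors makes the eigenvalues positive.\<close>

lemma spd_matrix_sqrt_exists:
  assumes A: "spd_matrix A"
  shows "\<exists>B. spd_matrix B \<and> B ** B = A"
proof -
  have sym: "transpose A = A" using A by (simp add: spd_matrix_def)
  obtain E \<nu> where "orthonormal_eigenbasis A E \<nu>"
    by (rule symmetric_matrix_orthonormal_eigenbasis[OF sym])
  note E = orthonormal_eigenbasisD[OF this]
  have \<nu>: "\<nu> e > 0" if "e \<in> E" for e
  proof -
    have "e \<noteq> 0" using E(3)[OF that that] by auto
    then have "0 < e \<bullet> (A *v e)" using A by (simp add: spd_matrix_def)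
    then show ?thesis using E(2,3) that by simp
  qed
  define g where "g = (\<lambda>v. \<Sum>e\<in>E. (sqrt (\<nu> e) * (e \<bullet> v)) *\<^sub>R e)"
  have g: "linear g"
    by (rule linearI)
      (simp_all add: g_def inner_add_right algebra_simps sum.distrib scaleR_sum_right)
  define B where "B = matrix g"
  have B: "B *v v = g v" for v using matrix_works g by (simp add: B_def)
  have coord: "e \<bullet> g v = sqrt (\<nu> e) * (e \<bullet> v)" if "e \<in> E" for e v
  proof -
    have "e \<bullet> g v = (\<Sum>e'\<in>E. if e = e' then sqrt (\<nu> e') * (e' \<bullet> v) else 0)"
      unfolding g_def inner_sum_right using that by (intro sum.cong) (auto simp: E(3))
    then show ?thesis using E(1) that by simp
  qed
  have "transpose B = B"
    by (rule symmetric_matrixI)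
      (simp add: B g_def inner_sum_right inner_sum_left inner_commute mult_ac)
  moreover have "0 < v \<bullet> (B *v v)" if v: "v \<noteq> 0" for v
  proof -
    have eq: "v \<bullet> (B *v v) = (\<Sum>e\<in>E. sqrt (\<nu> e) * (e \<bullet> v)\<^sup>2)"
      by (simp add: B g_def inner_sum_right inner_commute power2_eq_square mult_ac)
    \<comment> \<open>If all coordinates vanished, the expansion of \<open>v\<close> would be
      zero.\<close>
    have "\<exists>e\<in>E. e \<bullet> v \<noteq> 0"
      using E(4)[of v] v by (metis (no_types, lifting) scale_zero_left sum.neutral)
    then obtain e where "e \<in> E" "e \<bullet> v \<noteq> 0" by blast
    then show ?thesis unfolding eq using E(1) \<nu>
      by (intro sum_pos2[of _ e]) (auto simp: less_imp_le)
  qed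
  moreover have "B ** B = A"
  proof -
    have "g (g v) = A *v v" for v
    proof -
      have "g (g v) = (\<Sum>e\<in>E. (sqrt (\<nu> e) * (e \<bullet> g v)) *\<^sub>R e)" by (simp only: g_def)
      also have "\<dots> = (\<Sum>e\<in>E. (e \<bullet> v) *\<^sub>R (A *v e))"
      proof (intro sum.cong refl)
        fix e assume e: "e \<in> E"
        have "sqrt (\<nu> e) * (e \<bullet> g v) = (sqrt (\<nu> e) * sqrt (\<nu> e)) * (e \<bullet> v)"
          by (simp only: coord[OF e] mult.assoc)
        also have "\<dots> = (e \<bullet> v) * \<nu> e" using \<nu>[OF e] by simp
        finally show "(sqrt (\<nu> e) * (e \<bullet> g v)) *\<^sub>R e = (e \<bullet> v) *\<^sub>R (A *v e)"
          by (simp add: E(2)[OF e])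
      qed
      also have "\<dots> = A *v (\<Sum>e\<in>E. (e \<bullet> v) *\<^sub>R e)"
        by (simp add: linear_sum[OF matrix_vector_mul_linear] matrix_vector_mult_scaleR)
      finally show ?thesis using E(4)[of v] by simp
    qed
    then show ?thesis by (simp add: matrix_eq B flip: matrix_vector_mul_assoc)
  qed
  ultimately show ?thesis by (auto simp: spd_matrix_def)
qed

text \<open>By linearity it is enough to compare \<open>B\<close> and \<open>C\<close> on an
  eigenbasis of \<open>C\<close>. With existence, this makes the definite description in
  \<open>matrix_sqrt\<close> denote a root.\<close>

lemma spd_matrix_sqrt_unique:
  assumes B: "spd_matrix B" and C: "spd_matrix C" and eq: "B ** B = C ** C"
  shows "B = C"
proof -
  have sym: "transpose C = C" using C by (simp add: spd_matrix_def)
  obtain E \<nu> where "orthonormal_eigenbasis C E \<nu>"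
    by (rule symmetric_matrix_orthonormal_eigenbasis[OF sym])
  note E = orthonormal_eigenbasisD[OF this]
  have Be: "B *v e = C *v e" if e: "e \<in> E" for e
  proof -
    have "e \<noteq> 0" using E(3)[OF e e] by auto
    then have "0 < e \<bullet> (C *v e)" using C by (simp add: spd_matrix_def)
    then have \<nu>: "\<nu> e > 0" using E(2,3) e by simp
    \<comment> \<open>\<open>(B + \<nu>) (B - \<nu>) e = 0\<close>, and \<open>B + \<nu>\<close> is positive definite.\<close>
    define w where "w = B *v e - \<nu> e *\<^sub>R e"
    have "B *v (B *v e) = C *v (C *v e)" using eq by (simp add: matrix_vector_mul_assoc)
    \<comment> \<open>B w = B B e - \<nu> B e = \<nu>^2 e - \<nu> B e = -\<nu> w.\<close>
    then have "B *v w = - (\<nu> e *\<^sub>R w)"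
      by (simp add: w_def E(2)[OF e] matrix_vector_mult_scaleR matrix_vector_mult_diff_distrib
          scaleR_diff_right)
    then have "w \<bullet> (B *v w) = - (\<nu> e * (w \<bullet> w))" by simp
    then have "\<not> 0 < w \<bullet> (B *v w)" using \<nu> by (simp add: not_less)
    then have "w = 0" using B by (auto simp: spd_matrix_def)
    then show ?thesis by (simp add: w_def E(2)[OF e])
  qed
  have "B *v v = C *v v" for v
  proof -
    have exp: "D *v v = (\<Sum>e\<in>E. (e \<bullet> v) *\<^sub>R (D *v e))" for D :: "real ^ 'a ^ 'a"
      by (subst E(4)[of v])
        (simp add: linear_sum[OF matrix_vector_mul_linear] matrix_vector_mult_scaleR)
    show ?thesis by (simp add: exp Be)
  qed
  then show ?thesis by (simp add: matrix_eq)
qed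

lemma matrix_sqrt_spd:
  assumes "spd_matrix A"
  shows "spd_matrix (matrix_sqrt A)" and "matrix_sqrt A ** matrix_sqrt A = A"
proof -
  have "\<exists>!B. spd_matrix B \<and> B ** B = A"
    using spd_matrix_sqrt_exists[OF assms] spd_matrix_sqrt_unique by metis
  from theI'[OF this]
  show "spd_matrix (matrix_sqrt A)" and "matrix_sqrt A ** matrix_sqrt A = A"
    by (simp_all add: matrix_sqrt_def)
qed

section \<open>The Bauer-Fike bound\<close>

lemma matrix_inv_mult:
  fixes A :: "real ^ 'm ^ 'm::finite"
  assumes "invertible A"
  shows "A ** matrix_inv A = mat 1" and "matrix_inv A ** A = mat 1"
  using someI_ex[OF assms[unfolded invertible_def], folded matrix_inv_def] by auto

lemma norm_matrix_vector_mult_le: "norm (A *v v) \<le> matrix_norm A * norm v"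
  unfolding matrix_norm_def by (rule onorm) simp

lemma matrix_norm_nonneg: "0 \<le> matrix_norm A"
  unfolding matrix_norm_def by (rule onorm_pos_le) simp

text \<open>Splitting a complex eigenvector into u + i v turns its equation into two real ones, to
  which the real spectral theorem and the real operator norm apply.\<close>

lemma complex_eigenvalue_iff_real:
  "complex_eigenvalue A z \<longleftrightarrow>
     (\<exists>u v. (u \<noteq> 0 \<or> v \<noteq> 0) \<and> A *v u = Re z *\<^sub>R u - Im z *\<^sub>R v \<and> A *v v = Im z *\<^sub>R u + Re z *\<^sub>R v)"
  (is "_ \<longleftrightarrow> ?R")
proof
  assume "complex_eigenvalue A z"
  then obtain w where w: "w \<noteq> 0" "map_matrix complex_of_real A *v w = z *s w"
    by (auto simp: complex_eigenvalue_def)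
  define u v where "u = (\<chi> i. Re (w $ i))" and "v = (\<chi> i. Im (w $ i))"
  have eq: "(\<Sum>j\<in>UNIV. complex_of_real (A $ i $ j) * w $ j) = z * w $ i" for i
    using w(2) by (simp add: vec_eq_iff matrix_vector_mult_def)
  have "u \<noteq> 0 \<or> v \<noteq> 0"
    using w(1) by (auto simp: u_def v_def vec_eq_iff complex_eq_iff)
  moreover have "A *v u = Re z *\<^sub>R u - Im z *\<^sub>R v"
    using arg_cong[OF eq, of Re] by (simp add: vec_eq_iff matrix_vector_mult_def u_def v_def)
  moreover have "A *v v = Im z *\<^sub>R u + Re z *\<^sub>R v"
    using arg_cong[OF eq, of Im]
    by (simp add: vec_eq_iff matrix_vector_mult_def u_def v_def algebra_simps)
  ultimately show ?R by blast
next
  assume ?R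
  then obtain u v where uv: "u \<noteq> 0 \<or> v \<noteq> 0" "A *v u = Re z *\<^sub>R u - Im z *\<^sub>R v"
    "A *v v = Im z *\<^sub>R u + Re z *\<^sub>R v" by blast
  define w where "w = (\<chi> i. Complex (u $ i) (v $ i))"
  have "w \<noteq> 0"
    using uv(1) by (auto simp: w_def vec_eq_iff complex_eq_iff)
  moreover have "map_matrix complex_of_real A *v w = z *s w"
    using uv(2,3)
    by (simp add: vec_eq_iff complex_eq_iff matrix_vector_mult_def w_def algebra_simps)
  ultimately show "complex_eigenvalue A z" by (auto simp: complex_eigenvalue_def)
qed

text \<open>\<open>P\<close> carries eigenvectors of \<open>S\<close> to eigenvectors of
  \<open>M\<close>, so the candidates for \<open>\<mu>\<close> are the real eigenvalues \<nu> e of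
  \<open>S\<close>. If all of them were farther than the bound from \<open>z\<close>, the
  transformed residual would be too large for its norm estimate. No inverse of S - z is formed, so
  \<open>z\<close> in the spectrum of \<open>M\<close> is no special case.\<close>

theorem bauer_fike_symmetrizable:
  fixes M M' P S :: "real ^ 'm ^ 'm::finite"
  assumes S: "transpose S = S" and P: "invertible P" and MP: "M ** P = P ** S"
    and z: "complex_eigenvalue M' z"
  obtains \<mu> :: real where "complex_eigenvalue M (of_real \<mu>)"
    "cmod (of_real \<mu> - z) \<le> condition_number P * matrix_norm (M - M')"
proof -
  obtain B \<nu> where "orthonormal_eigenbasis S B \<nu>"
    by (rule symmetric_matrix_orthonormal_eigenbasis[OF S])
  note B = orthonormal_eigenbasisD[OF this]
  define a b where "a = Re z" and "b = Im z"
  obtain u v where uv: "u \<noteq> 0 \<or> v \<noteq> 0" "M' *v u = a *\<^sub>R u - b *\<^sub>R v" "M' *v v = b *\<^sub>R u + a *\<^sub>R v"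
    using z unfolding complex_eigenvalue_iff_real a_def b_def by blast
  define Q where "Q = matrix_inv P"
  have PQ: "P *v (Q *v y) = y" and QP: "Q *v (P *v y) = y" for y
    using matrix_inv_mult[OF P] by (simp_all add: Q_def matrix_vector_mul_assoc)
  have MS: "Q *v (M *v y) = S *v (Q *v y)" for y
  proof -
    have "M *v (P *v (Q *v y)) = P *v (S *v (Q *v y))"
      by (metis MP matrix_vector_mul_assoc)
    then show ?thesis by (simp add: PQ QP)
  qed
  define k where "k = condition_number P * matrix_norm (M - M')"
  have k: "0 \<le> k" by (simp add: k_def condition_number_def matrix_norm_nonneg)
  \<comment> \<open>Both factors of the condition number arise here: |Q| from the outer product, |P|
    from writing y as P (Q y).\<close>
  have residual: "norm (Q *v ((M - M') *v y)) \<le> k * norm (Q *v y)" for y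
  proof -
    have "norm (Q *v ((M - M') *v y)) \<le> matrix_norm Q * norm ((M - M') *v y)"
      by (rule norm_matrix_vector_mult_le)
    also have "\<dots> \<le> matrix_norm Q * (matrix_norm (M - M') * norm y)"
      by (intro mult_left_mono norm_matrix_vector_mult_le matrix_norm_nonneg)
    also have "norm y = norm (P *v (Q *v y))" by (simp add: PQ)
    also have "matrix_norm Q * (matrix_norm (M - M') * \<dots>)
        \<le> matrix_norm Q * (matrix_norm (M - M') * (matrix_norm P * norm (Q *v y)))"
      by (intro mult_left_mono norm_matrix_vector_mult_le matrix_norm_nonneg)
    finally show ?thesis by (simp add: k_def condition_number_def Q_def mult_ac)
  qed
  define p q where "p = Q *v u" and "q = Q *v v"
  have pq: "p \<noteq> 0 \<or> q \<noteq> 0"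
    using uv(1) PQ unfolding p_def q_def by (metis matrix_vector_mult_0_right)
  \<comment> \<open>These are the real and imaginary parts of (S - z)(p + i q).\<close>
  define r s where "r = S *v p - a *\<^sub>R p + b *\<^sub>R q" and "s = S *v q - b *\<^sub>R p - a *\<^sub>R q"
  have r: "r = Q *v ((M - M') *v u)" and s: "s = Q *v ((M - M') *v v)"
    by (simp_all add: r_def s_def p_def q_def uv matrix_vector_mult_diff_rdistrib
        matrix_vector_mult_diff_distrib matrix_vector_mult_scaleR matrix_vector_right_distrib MS)
  \<comment> \<open>Bounding both parts separately and adding squares gives the complex estimate
    with the same constant \<open>k\<close>.\<close>
  have "(norm r)\<^sup>2 \<le> (k * norm p)\<^sup>2" "(norm s)\<^sup>2 \<le> (k * norm q)\<^sup>2"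
    unfolding r s p_def q_def by (intro power_mono residual norm_ge_zero)+
  then have le: "(norm r)\<^sup>2 + (norm s)\<^sup>2 \<le> k\<^sup>2 * ((norm p)\<^sup>2 + (norm q)\<^sup>2)"
    by (simp add: power_mult_distrib algebra_simps)
  \<comment> \<open>\<open>D e\<close> is |\<nu> e - z|^2, and \<open>W e\<close> is the squared
    modulus of the coordinate of p + i q along \<open>e\<close>.\<close>
  define D where "D = (\<lambda>e. (\<nu> e - a)\<^sup>2 + b\<^sup>2)"
  define W where "W = (\<lambda>e. (e \<bullet> p)\<^sup>2 + (e \<bullet> q)\<^sup>2)"
  have sumW: "(norm p)\<^sup>2 + (norm q)\<^sup>2 = (\<Sum>e\<in>B. W e)"
    by (simp add: W_def parseval[OF B(4)] sum.distrib)
  \<comment> \<open>Multiplicativity of the squared complex modulus: the cross terms of the real and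
    imaginary parts cancel.\<close>
  have "(e \<bullet> r)\<^sup>2 + (e \<bullet> s)\<^sup>2 = D e * W e" if e: "e \<in> B" for e
  proof -
    have "e \<bullet> (S *v y) = \<nu> e * (e \<bullet> y)" for y
      using symmetric_matrix_inner[OF S, of e y] by (simp add: B(2)[OF e])
    then show ?thesis
      by (simp add: r_def s_def D_def W_def inner_diff_right inner_add_right power2_eq_square
          algebra_simps)
  qed
  then have sumD: "(norm r)\<^sup>2 + (norm s)\<^sup>2 = (\<Sum>e\<in>B. D e * W e)"
    by (simp add: parseval[OF B(4)] flip: sum.distrib)
  have "\<exists>e\<in>B. D e \<le> k\<^sup>2"
  proof (rule ccontr)
    assume "\<not> ?thesis"
    then have D: "k\<^sup>2 < D e" if "e \<in> B" for e using that by force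
    have W: "0 \<le> W e" for e by (simp add: W_def)
    \<comment> \<open>One positive weight makes the summed inequality strict, as the contradiction
      with \<open>le\<close> requires.\<close>
    have "0 < (norm p)\<^sup>2 + (norm q)\<^sup>2" using pq by (auto simp: add_pos_nonneg add_nonneg_pos)
    then obtain e where e: "e \<in> B" "0 < W e"
      unfolding sumW using sum_nonpos[of B W] by force
    have "k\<^sup>2 * (\<Sum>e\<in>B. W e) < (\<Sum>e\<in>B. D e * W e)"
      unfolding sum_distrib_left
    proof (rule sum_strict_mono_ex1[OF B(1)])
      show "\<forall>e\<in>B. k\<^sup>2 * W e \<le> D e * W e"
        using W D by (simp add: mult_right_mono less_imp_le)
      show "\<exists>e\<in>B. k\<^sup>2 * W e < D e * W e"
        using e D[OF e(1)] by (intro bexI[of _ e] mult_strict_right_mono) auto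
    qed
    then show False using le by (simp add: sumW sumD)
  qed
  then obtain e where e: "e \<in> B" "D e \<le> k\<^sup>2" by blast
  show ?thesis
  proof
    have "e \<noteq> 0" using B(3)[OF e(1) e(1)] by auto
    then have "P *v e \<noteq> 0" using QP[of e] by auto
    moreover have "M *v (P *v e) = \<nu> e *\<^sub>R (P *v e)"
      by (simp add: matrix_vector_mul_assoc MP)
        (simp add: B(2)[OF e(1)] matrix_vector_mult_scaleR flip: matrix_vector_mul_assoc)
    ultimately show "complex_eigenvalue M (of_real (\<nu> e))"
      unfolding complex_eigenvalue_iff_real
      by (intro exI[of _ "P *v e"] exI[of _ 0]) simp
    have "cmod (of_real (\<nu> e) - z) = sqrt (D e)"
      by (simp add: cmod_def D_def a_def b_def)
    also have "\<dots> \<le> k" using e(2) k by (simp add: real_le_lsqrt)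
    finally show "cmod (of_real (\<nu> e) - z) \<le> condition_number P * matrix_norm (M - M')"
      by (simp add: k_def)
  qed
qed

section \<open>Kernel matrices\<close>

text \<open>The partial sums at (x, y) and (y, x) coincide, so their limits do too.\<close>

lemma zonal_kernel_commute:
  assumes "zonal_kernel n Y c \<Phi>" "x \<in> sphere 0 1" "y \<in> sphere 0 1"
  shows "\<Phi> x y = \<Phi> y x"
proof -
  have lim: "(\<lambda>k. \<Sum>l<k. \<Sum>m=1..n l. c l * Y l m x * Y l m y) \<longlonglongrightarrow> \<Phi> x y"
    if "x \<in> sphere 0 1" "y \<in> sphere 0 1" for x y
    using tendsto_uniform_limitI[OF conjunct2[OF assms(1)[unfolded zonal_kernel_def]], of "(x, y)"]
      that by simp
  have "(\<lambda>k. \<Sum>l<k. \<Sum>m=1..n l. c l * Y l m x * Y l m y) \<longlonglongrightarrow> \<Phi> y x"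
    using lim[OF assms(3,2)] by (simp add: mult_ac)
  with lim[OF assms(2,3)] show ?thesis by (rule LIMSEQ_unique)
qed

text \<open>The operator only rescales the coefficients, so each summand stays symmetric. This is
  the source of the symmetry of the matrix K.\<close>

lemma operator_kernel_commute: "operator_kernel d p n Y c x y = operator_kernel d p n Y c y x"
  by (simp add: operator_kernel_def zonal_series_def mult_ac)

text \<open>Kernel definiteness speaks of weights on a set of points, matrix definiteness of vectors
  indexed by \<open>'m\<close>; the injective enumeration \<open>x\<close> translates between
  them.\<close>

lemma spd_kernel_matrix:
  fixes x :: "'m::finite \<Rightarrow> 'a::euclidean_space"
  assumes "inj x" "range x \<subseteq> sphere 0 1" "positive_definite_kernel \<Phi>"
    and sym: "\<And>y z. y \<in> sphere 0 1 \<Longrightarrow> z \<in> sphere 0 1 \<Longrightarrow> \<Phi> y z = \<Phi> z y"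
  shows "spd_matrix (kernel_matrix \<Phi> x)"
  unfolding spd_matrix_def
proof (intro conjI allI impI)
  show "transpose (kernel_matrix \<Phi> x) = kernel_matrix \<Phi> x"
    using assms(2) by (auto simp: transpose_def kernel_matrix_def vec_eq_iff image_subset_iff intro!: sym)
  fix v :: "real ^ 'm" assume "v \<noteq> 0"
  then obtain i where i: "v $ i \<noteq> 0" by (auto simp: vec_eq_iff)
  define w where "w = (\<lambda>y. v $ inv x y)"
  have w: "w (x j) = v $ j" for j using assms(1) by (simp add: w_def)
  have "\<exists>y\<in>range x. w y \<noteq> 0" using i by (auto simp: w)
  have "0 < (\<Sum>y\<in>range x. \<Sum>z\<in>range x. w y * \<Phi> y z * w z)"
    by (rule assms(3)[unfolded positive_definite_kernel_def, rule_format])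
      (simp, fact+)
  also have "\<dots> = v \<bullet> (kernel_matrix \<Phi> x *v v)"
    using assms(1)
    by (simp add: sum.reindex w inner_vec_def kernel_matrix_def matrix_vector_mult_def
        sum_distrib_left mult.assoc)
  finally show "0 < v \<bullet> (kernel_matrix \<Phi> x *v v)" .
qed

theorem proposition3p1:
  fixes d :: nat
    and n :: "nat \<Rightarrow> nat"
    and Y :: "nat \<Rightarrow> nat \<Rightarrow> real ^ 'n \<Rightarrow> real"
    and c :: "nat \<Rightarrow> real"
    and \<Phi> :: "real ^ 'n \<Rightarrow> real ^ 'n \<Rightarrow> real"
    and p :: "real \<Rightarrow> real"
    and X :: "(real ^ 'n) set"
    and x :: "'m::finite \<Rightarrow> real ^ 'n"
    and M M' :: "real ^ 'm ^ 'm"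
  assumes "d \<ge> 2"
    and "CARD('n) = d + 1"
    and "spherical_harmonic_basis n Y"
    and "zonal_kernel n Y c \<Phi>"
    and "positive_definite_kernel \<Phi>"
    and "\<exists>k::nat. (\<lambda>l. p (lb_eigenvalue d l)) \<in> O(\<lambda>l. real l ^ k)"
    and "summable (\<lambda>l. c l * \<bar>p (lb_eigenvalue d l)\<bar> * real l ^ (d - 1))"
    and "finite X" and "X \<subseteq> sphere 0 1" and "bij_betw x UNIV X"
    and "M = differentiation_matrix (operator_kernel d p n Y c) \<Phi> x"
  shows "\<forall>\<mu>'. complex_eigenvalue M' \<mu>' \<longrightarrow>
           (\<exists>\<mu>. complex_eigenvalue M \<mu> \<and>
              cmod (\<mu> - \<mu>') \<le> condition_number (matrix_sqrt (kernel_matrix \<Phi> x)) * matrix_norm (M - M'))"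
proof (intro allI impI)
  fix \<mu>' assume ev: "complex_eigenvalue M' \<mu>'"
  let ?F = "kernel_matrix \<Phi> x" and ?K = "kernel_matrix (operator_kernel d p n Y c) x"
  have "inj x" "range x \<subseteq> sphere 0 1"
    using assms(9,10) by (auto simp: bij_betw_def)
  then have F: "spd_matrix ?F"
    using assms(5) zonal_kernel_commute[OF assms(4)] by (rule spd_kernel_matrix)
  define B where "B = matrix_sqrt ?F"
  have B: "spd_matrix B" and BB: "B ** B = ?F" using matrix_sqrt_spd[OF F] by (simp_all add: B_def)
  have inv: "invertible B" using B by (rule spd_matrix_invertible)
  define Q where "Q = matrix_inv B"
  have BQ: "B ** Q = mat 1" "Q ** B = mat 1" using matrix_inv_mult[OF inv] by (simp_all add: Q_def)
  have TB: "transpose B = B" using B by (simp add: spd_matrix_def)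
  \<comment> \<open>Transposing Q B = 1 shows that the transpose of \<open>Q\<close> is also a right
    inverse of \<open>B\<close>, hence equal to \<open>Q\<close>.\<close>
  have "B ** transpose Q = mat 1"
    by (metis BQ(2) TB matrix_transpose_mul transpose_mat)
  then have TQ: "transpose Q = Q" by (metis BQ(2) matrix_mul_assoc matrix_mul_lid matrix_mul_rid)
  have TK: "transpose ?K = ?K"
    by (simp add: transpose_def kernel_matrix_def vec_eq_iff operator_kernel_commute[of d p n Y c "x _" "x _"])
  \<comment> \<open>A congruence of K by the symmetric matrix \<open>Q\<close>, hence symmetric.
    With F the collocation matrix, \<open>F\<^sup>-\<^sup>1 = Q ** Q\<close> gives M B = K Q Q B = K
    Q = B S.\<close>
  define S where "S = Q ** ?K ** Q"
  have "transpose S = S" by (simp add: S_def matrix_transpose_mul TQ TK matrix_mul_assoc)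
  moreover have "M ** B = B ** S"
  proof -
    have "matrix_inv ?F = Q ** Q"
    proof -
      have "?F ** (Q ** Q) = mat 1"
        by (metis BB BQ(1) matrix_mul_assoc matrix_mul_rid)
      then show ?thesis
        by (metis F spd_matrix_invertible matrix_inv_mult(2) matrix_mul_assoc matrix_mul_lid matrix_mul_rid)
    qed
    then have "M ** B = ?K ** Q ** (Q ** B)"
      by (simp add: assms(11) differentiation_matrix_def matrix_mul_assoc)
    also have "\<dots> = ?K ** Q" by (simp add: BQ)
    also have "\<dots> = B ** S" by (simp add: S_def matrix_mul_assoc BQ)
    finally show ?thesis .
  qed
  ultimately show "\<exists>\<mu>. complex_eigenvalue M \<mu> \<and>
      cmod (\<mu> - \<mu>') \<le> condition_number (matrix_sqrt ?F) * matrix_norm (M - M')"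
    using bauer_fike_symmetrizable[OF _ inv _ ev] unfolding B_def by metis
qed

end
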